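(* Let $0<p_0<1/2$. There is a constant $C_1=C_1(p_0)$ such that the following holds. Let $W:[0,1]^2\to[p_0,1-p_0]$ be symmetric and Lipschitz with least Lipschitz constant $L>0$, let $G\sim\mathcal G(n,W)$ with types $x$, and let $B$ be the window defined in the context. Then for all $S,S'\subseteq B$ with $|S|=|S'|=y$ and $\kappa=|S\cap S'|\ge2$, $$\mathbb P(A_S\cap A_{S'}\mid x)\;\le\;\mathbb P(A_S\mid x)\cdot y\,\Bigl(\frac{C_1}{\sqrt\kappa}\Bigr)^{y-\kappa},$$ with the convention $(\,\cdot\,)^0=1$, so that the case $\kappa=y$ (full overlap) is included.
   Context: Model $\mathcal G(n,W)$: draw $x_1,\dots,x_n$ (the types) i.i.d. uniform on $[0,1]$; given $x=(x_1,\dots,x_n)$, join $i\sim j$ independently for distinct pairs, with probability $W(x_i,x_j)$. $\mathbb P(\cdot\mid x)$ is conditional on the types, over the edge randomness only. Window: for $w\in(0,1]$ and fixed $c_0\in[0,1-w]$, $B:=\{i:x_i\in[c_0,c_0+w]\}$. For a vertex set $S$, $A_S$ is the event that the induced subgraph $G[S]$ is regular (all its degrees are equal). *)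

theory Defs
  imports "HOL-Probability.Probability"
begin

(* Vertices are 1, ..., n; a graph on them is its set of two-element edges. *)

definition vertex_pairs :: "nat \<Rightarrow> (nat \<times> nat) set" where
  "vertex_pairs n = {(i, j). 1 \<le> i \<and> i < j \<and> j \<le> n}"

(* The law P( . | x) of G(n,W) given the types x: one independent coin per
   unordered pair, indexed by its increasing representative. *)
definition cond_graph_pmf ::
    "nat \<Rightarrow> (real \<Rightarrow> real \<Rightarrow> real) \<Rightarrow> (nat \<Rightarrow> real) \<Rightarrow> nat set set pmf" where
  "cond_graph_pmf n W x =
     map_pmf (\<lambda>\<omega>. {{i, j} | i j. (i, j) \<in> vertex_pairs n \<and> \<omega> (i, j)})
       (Pi_pmf (vertex_pairs n) False (\<lambda>(i, j). bernoulli_pmf (W (x i) (x j))))"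

definition induced_edges :: "nat set set \<Rightarrow> nat set \<Rightarrow> nat set set" where
  "induced_edges E S = {e \<in> E. e \<subseteq> S}"

definition degree_in :: "nat set set \<Rightarrow> nat \<Rightarrow> nat" where
  "degree_in E v = card {e \<in> E. v \<in> e}"

definition regular_event :: "nat set \<Rightarrow> nat set set set" where
  "regular_event S =
     {E. \<exists>d. \<forall>v\<in>S. degree_in (induced_edges E S) v = d}"

definition window :: "nat \<Rightarrow> (nat \<Rightarrow> real) \<Rightarrow> real \<Rightarrow> real \<Rightarrow> nat set" where
  "window n x c0 w = {i \<in> {1..n}. x i \<in> {c0..c0 + w}}"

definition least_lipschitz_const ::
    "real \<Rightarrow> 'a::metric_space set \<Rightarrow> ('a \<Rightarrow> 'b::metric_space) \<Rightarrow> bool" where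
  "least_lipschitz_const L X f \<longleftrightarrow>
     L-lipschitz_on X f \<and> (\<forall>M. M-lipschitz_on X f \<longrightarrow> L \<le> M)"

end

theory Submission imports Defs begin

text \<open>
  Put \<open>K = S \<inter> S'\<close> and \<open>T = S' - S\<close>, so that \<open>K\<close> has \<open>\<kappa>\<close> elements and \<open>T\<close> has \<open>y - \<kappa>\<close>. The edges
  between \<open>K\<close> and \<open>T\<close> do not lie inside \<open>S\<close>, hence they are independent of the event that \<open>G[S]\<close> is
  regular. Reveal all other edges, and fix the common degree \<open>d < y\<close> that \<open>G[S']\<close> is to have. Every
  \<open>v \<in> T\<close> must then have a prescribed number of neighbours in \<open>K\<close>, namely \<open>d\<close> minus its number of
  neighbours in \<open>T\<close>. These numbers of neighbours, for distinct \<open>v \<in> T\<close>, come from disjoint stars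
  of coins; each is a sum of \<open>\<kappa>\<close> independent coins with biases in \<open>[p0, 1 - p0]\<close>, which takes any
  given value with probability at most \<open>C1 / sqrt \<kappa>\<close>. So each vertex of \<open>T\<close> costs one such
  factor (\<open>prob_fresh_coin_families\<close>), and the union bound over \<open>d\<close> costs the factor \<open>y\<close>
  (\<open>prob_regular_both_le\<close>).

  The anti-concentration bound (\<open>heads_pmf_anticoncentration\<close>) is proved without Fourier analysis or
  a local limit theorem. Let \<open>u\<close> be the collision probability of the number of heads, that is, the
  sum of the squares of its point probabilities \<open>a k\<close>. One more coin of bias \<open>q\<close> lowers \<open>u\<close> by
  exactly \<open>q (1 - q) D\<close>, where \<open>D\<close> is the sum of \<open>(a k - a (k - 1))\<^sup>2\<close>. A discrete form of Nash's
  inequality gives \<open>u\<^sup>3 \<le> 4 D\<close>. Thus \<open>u\<close> obeys a discrete version of the differential inequality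
  \<open>u' \<le> - c u\<^sup>3\<close> with \<open>c = p0 (1 - p0) / 4\<close>, and after \<open>m\<close> coins \<open>u \<le> 1 / sqrt (1 + 2 c m)\<close>.
  To pass from collision probabilities to point probabilities, split the coins into two halves:
  by the Cauchy-Schwarz inequality, a point probability of the sum of two independent
  variables is at most the geometric mean of their collision probabilities.
\<close>

section \<open>Anti-concentration of sums of independent coins\<close>

abbreviation coin_flips :: "'a set \<Rightarrow> ('a \<Rightarrow> real) \<Rightarrow> ('a \<Rightarrow> bool) pmf" where
  "coin_flips A p \<equiv> Pi_pmf A False (\<lambda>a. bernoulli_pmf (p a))"

definition heads_pmf :: "'a set \<Rightarrow> ('a \<Rightarrow> real) \<Rightarrow> nat pmf" where
  "heads_pmf A p = map_pmf (\<lambda>\<omega>. card {a \<in> A. \<omega> a}) (coin_flips A p)"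

text \<open>
  The probability that two independent copies of the number of heads agree, in other words the squared
  \<open>l\<^sub>2\<close> norm of its distribution. The range of summation contains the support.
\<close>

definition collision :: "'a set \<Rightarrow> ('a \<Rightarrow> real) \<Rightarrow> real" where
  "collision A p = (\<Sum>k\<le>card A. (pmf (heads_pmf A p) k)\<^sup>2)"

definition delayed :: "(nat \<Rightarrow> real) \<Rightarrow> nat \<Rightarrow> real" where
  "delayed a k = (case k of 0 \<Rightarrow> 0 | Suc j \<Rightarrow> a j)"

lemma delayed_simps [simp]: "delayed a 0 = 0" "delayed a (Suc k) = a k"
  by (simp_all add: delayed_def)

lemma sum_delayed: "(\<Sum>k\<le>Suc N. f (delayed a k)) = f 0 + (\<Sum>k\<le>N. f (a k))"
  by (simp add: sum.atMost_Suc_shift del: sum.atMost_Suc)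

text \<open>
  Telescoping \<open>(a k)\<^sup>2\<close> and applying Cauchy-Schwarz bounds the supremum of \<open>a\<close> by the \<open>l\<^sub>2\<close> norms
  of \<open>a\<close> and of its difference sequence: \<open>(sup a) ^ 4 \<le> 4 u D\<close>. Since \<open>a\<close> has mass \<open>1\<close>, also
  \<open>u \<le> sup a\<close>. Eliminating the supremum leaves the inequality: a distribution that is spread
  out little must have large differences.
\<close>

lemma discrete_Nash_inequality:
  fixes a :: "nat \<Rightarrow> real"
  assumes nonneg: "\<And>k. 0 \<le> a k" and supp: "\<And>k. k > N \<Longrightarrow> a k = 0"
    and sum1: "(\<Sum>k\<le>N. a k) = 1"
  shows "(\<Sum>k\<le>N. (a k)\<^sup>2) ^ 3 \<le> 4 * (\<Sum>k\<le>Suc N. (a k - delayed a k)\<^sup>2)"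
proof -
  define u where "u = (\<Sum>k\<le>N. (a k)\<^sup>2)"
  define D where "D = (\<Sum>k\<le>Suc N. (a k - delayed a k)\<^sup>2)"
  have u0: "u \<ge> 0" and D0: "D \<ge> 0"
    unfolding u_def D_def by (simp_all add: sum_nonneg)
  have delayed_nonneg: "delayed a k \<ge> 0" for k
    using nonneg by (cases k) auto
  have sq_a: "(\<Sum>k\<le>Suc N. (a k)\<^sup>2) = u"
    using supp[of "Suc N"] by (simp add: u_def)
  have sq_delayed: "(\<Sum>k\<le>Suc N. (delayed a k)\<^sup>2) = u"
    using sum_delayed[of "\<lambda>t. t\<^sup>2" a N] by (simp add: u_def)
  have plus: "(\<Sum>k\<le>Suc N. (a k + delayed a k)\<^sup>2) \<le> 4 * u"
  proof -
    have "(\<Sum>k\<le>Suc N. (a k + delayed a k)\<^sup>2) \<le> (\<Sum>k\<le>Suc N. 2 * (a k)\<^sup>2 + 2 * (delayed a k)\<^sup>2)"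
    proof (rule sum_mono)
      fix k
      have "0 \<le> (a k - delayed a k)\<^sup>2" by simp
      then show "(a k + delayed a k)\<^sup>2 \<le> 2 * (a k)\<^sup>2 + 2 * (delayed a k)\<^sup>2"
        by (simp add: power2_eq_square algebra_simps)
    qed
    also have "\<dots> = 2 * u + 2 * u"
      by (simp only: sum.distrib sum_distrib_left[symmetric] sq_a sq_delayed)
    finally show ?thesis by simp
  qed
  have pointwise: "((a k)\<^sup>2)\<^sup>2 \<le> 4 * u * D" if "k \<le> N" for k
  proof -
    have telescope: "(a m)\<^sup>2 = (\<Sum>j\<le>m. (a j - delayed a j) * (a j + delayed a j))" for m
      by (induction m) (simp_all add: power2_eq_square algebra_simps)
    have "(a k)\<^sup>2 \<le> (\<Sum>j\<le>k. \<bar>a j - delayed a j\<bar> * (a j + delayed a j))"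
      unfolding telescope using nonneg delayed_nonneg
      by (intro sum_mono mult_right_mono) (auto intro: add_nonneg_nonneg)
    also have "\<dots> \<le> (\<Sum>j\<le>Suc N. \<bar>a j - delayed a j\<bar> * (a j + delayed a j))"
      using that nonneg delayed_nonneg
      by (intro sum_mono2) (auto intro!: mult_nonneg_nonneg add_nonneg_nonneg)
    finally have "((a k)\<^sup>2)\<^sup>2 \<le> (\<Sum>j\<le>Suc N. \<bar>a j - delayed a j\<bar> * (a j + delayed a j))\<^sup>2"
      by (intro power_mono) auto
    also have "\<dots> \<le> D * (\<Sum>j\<le>Suc N. (a j + delayed a j)\<^sup>2)"
      using Cauchy_Schwarz_ineq_sum[of "\<lambda>j. \<bar>a j - delayed a j\<bar>" "\<lambda>j. a j + delayed a j" "{..Suc N}"]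
      unfolding D_def by (simp only: power2_abs)
    also have "\<dots> \<le> D * (4 * u)"
      using plus D0 by (rule mult_left_mono)
    finally show ?thesis by (simp add: mult_ac)
  qed
  \<comment> \<open>The fourth root, so that \<open>pointwise\<close> says that \<open>\<beta>\<close> is an upper bound of \<open>a\<close>.\<close>
  define \<beta> where "\<beta> = sqrt (sqrt (4 * u * D))"
  have "a k \<le> \<beta>" if "k \<le> N" for k
    unfolding \<beta>_def using pointwise[OF that] by (intro real_le_rsqrt) auto
  then have "u \<le> (\<Sum>k\<le>N. \<beta> * a k)"
    unfolding u_def power2_eq_square using nonneg by (intro sum_mono mult_right_mono) auto
  also have "\<dots> = \<beta>"
    using sum1 by (simp add: sum_distrib_left[symmetric])
  finally have "u ^ 4 \<le> \<beta> ^ 4"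
    using u0 by (intro power_mono) auto
  also have "\<beta> ^ 4 = (\<beta>\<^sup>2)\<^sup>2"
    by simp
  also have "\<dots> = 4 * u * D"
    unfolding \<beta>_def using u0 D0 by simp
  finally have "u * u ^ 3 \<le> u * (4 * D)"
    by (simp add: power_numeral_reduce mult_ac)
  then have "u ^ 3 \<le> 4 * D"
    using u0 D0 by (cases "u = 0") auto
  then show ?thesis
    unfolding u_def D_def .
qed

lemma heads_pmf_beyond: "pmf (heads_pmf A p) k = 0" if "finite A" "k > card A"
proof -
  have "card {a \<in> A. \<omega> a} \<le> card A" for \<omega>
    using that by (intro card_mono) auto
  then show ?thesis
    using that unfolding heads_pmf_def by (auto simp: pmf_eq_0_set_pmf not_le[symmetric])
qed

lemma heads_pmf_support: "k \<le> card A" if "finite A" "pmf (heads_pmf A p) k \<noteq> 0"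
  using heads_pmf_beyond[OF that(1), of k p] that(2) not_le by blast

lemma sum_heads_pmf: "(\<Sum>k\<le>card A. pmf (heads_pmf A p) k) = 1" if "finite A"
  using that by (intro sum_pmf_eq_1) (auto simp: set_pmf_iff dest: heads_pmf_support)

lemma heads_pmf_union:
  assumes "finite A" "finite B" "A \<inter> B = {}"
  shows "pmf (heads_pmf (A \<union> B) p) k = (\<Sum>j\<le>k. pmf (heads_pmf A p) j * pmf (heads_pmf B p) (k - j))"
proof -
  have split: "card {a \<in> A \<union> B. if a \<in> A then f a else g a} = card {a \<in> A. f a} + card {b \<in> B. g b}" for f g
  proof -
    have "{a \<in> A \<union> B. if a \<in> A then f a else g a} = {a \<in> A. f a} \<union> {b \<in> B. g b}"
      using assms by auto
    then show ?thesis
      using assms by (simp add: card_Un_disjoint disjoint_iff)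
  qed
  have "heads_pmf (A \<union> B) p = bind_pmf (heads_pmf A p) (\<lambda>j. map_pmf ((+) j) (heads_pmf B p))"
    unfolding heads_pmf_def Pi_pmf_union[OF assms] pair_pmf_def
    by (simp only: map_bind_pmf bind_map_pmf pmf.map_comp o_def map_return_pmf prod.case split)
      (simp add: map_pmf_def bind_assoc_pmf bind_return_pmf)
  moreover have "pmf (map_pmf ((+) j) (heads_pmf B p)) k = (if j \<le> k then pmf (heads_pmf B p) (k - j) else 0)" for j
  proof (cases "j \<le> k")
    case True
    then show ?thesis
      using pmf_map_inj'[of "(+) j" "heads_pmf B p" "k - j"] by simp
  next
    case False
    then show ?thesis
      by (auto simp: pmf_eq_0_set_pmf)
  qed
  ultimately have "pmf (heads_pmf (A \<union> B) p) k
      = (\<integral>j. (if j \<le> k then pmf (heads_pmf B p) (k - j) else 0) \<partial>heads_pmf A p)"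
    by (simp add: pmf_bind)
  also have "\<dots> = (\<Sum>j\<le>k. pmf (heads_pmf A p) j *\<^sub>R (if j \<le> k then pmf (heads_pmf B p) (k - j) else 0))"
    by (intro integral_measure_pmf) (auto split: if_splits)
  finally show ?thesis by simp
qed

lemma heads_pmf_insert:
  assumes "finite A" "x \<notin> A" "p x \<in> {0..1}"
  shows "pmf (heads_pmf (insert x A) p) k
    = (1 - p x) * pmf (heads_pmf A p) k + p x * delayed (pmf (heads_pmf A p)) k"
proof -
  have "heads_pmf {x} p = map_pmf of_bool (bernoulli_pmf (p x))"
    unfolding heads_pmf_def Pi_pmf_singleton pmf.map_comp o_def
    by (intro map_pmf_cong) (auto simp: Collect_conv_if)
  then have single: "pmf (heads_pmf {x} p) 0 = 1 - p x" "pmf (heads_pmf {x} p) (Suc 0) = p x"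
    using pmf_map_inj'[of "of_bool :: bool \<Rightarrow> nat" "bernoulli_pmf (p x)" False]
      pmf_map_inj'[of "of_bool :: bool \<Rightarrow> nat" "bernoulli_pmf (p x)" True] assms(3)
    by (auto simp: inj_def of_bool_def split: if_splits)
  have "pmf (heads_pmf (insert x A) p) k = (\<Sum>j\<le>k. pmf (heads_pmf {x} p) j * pmf (heads_pmf A p) (k - j))"
    using heads_pmf_union[of "{x}" A p k] assms by simp
  also have "\<dots> = (\<Sum>j\<in>{..k} \<inter> {0, 1}. pmf (heads_pmf {x} p) j * pmf (heads_pmf A p) (k - j))"
    by (intro sum.mono_neutral_right) (auto dest: heads_pmf_support[rotated])
  also have "\<dots> = (1 - p x) * pmf (heads_pmf A p) k + p x * delayed (pmf (heads_pmf A p)) k"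
    using single by (cases k) auto
  finally show ?thesis .
qed

text \<open>
  The new distribution is the mixture of \<open>a\<close> and its translate, with weights \<open>1 - p x\<close> and \<open>p x\<close>.
  Both have the same \<open>l\<^sub>2\<close> norm, so the parallelogram-type identity
  \<open>((1 - q) s + q t)\<^sup>2 = (1 - q) s\<^sup>2 + q t\<^sup>2 - q (1 - q) (s - t)\<^sup>2\<close> gives the exact loss.
\<close>

lemma collision_insert:
  assumes "finite A" "x \<notin> A" "p x \<in> {0..1}"
  defines "a \<equiv> pmf (heads_pmf A p)"
  shows "collision (insert x A) p
    = collision A p - p x * (1 - p x) * (\<Sum>k\<le>Suc (card A). (a k - delayed a k)\<^sup>2)"
proof -
  have "collision A p = (\<Sum>k\<le>Suc (card A). (a k)\<^sup>2)"
    using heads_pmf_beyond[OF assms(1), of "Suc (card A)" p] by (simp add: collision_def a_def)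
  moreover have "collision A p = (\<Sum>k\<le>Suc (card A). (delayed a k)\<^sup>2)"
    using sum_delayed[of "\<lambda>t. t\<^sup>2" a "card A"] by (simp add: collision_def a_def)
  moreover have "collision (insert x A) p = (\<Sum>k\<le>Suc (card A). (1 - p x) * (a k)\<^sup>2 + p x * (delayed a k)\<^sup>2
      - p x * (1 - p x) * (a k - delayed a k)\<^sup>2)"
    using assms(1,2) unfolding collision_def
    by (intro sum.cong)
      (simp_all add: heads_pmf_insert[OF assms(1,2), of p, OF assms(3), folded a_def] power2_eq_square algebra_simps)
  ultimately show ?thesis
    by (simp only: sum.distrib sum_subtractf sum_distrib_left[symmetric]) (simp add: algebra_simps)
qed

lemma collision_nonneg: "collision A p \<ge> 0"
  unfolding collision_def by (simp add: sum_nonneg)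

text \<open>
  By the exact loss formula and the Nash inequality, adding a coin turns \<open>u\<close> into \<open>u' \<le> u - c u\<^sup>3\<close>. The quantity
  \<open>1 / u\<^sup>2\<close> then grows by at least \<open>2 c\<close> per coin; the statement is this growth with the
  denominators cleared.
\<close>

lemma collision_bound:
  assumes "0 < p0" "p0 < 1 / 2" "finite A" "\<And>x. x \<in> A \<Longrightarrow> p x \<in> {p0..1 - p0}"
  defines "c \<equiv> p0 * (1 - p0) / 4"
  shows "(collision A p)\<^sup>2 * (1 + 2 * c * card A) \<le> 1"
  using assms(3,4)
proof (induction A rule: finite_induct)
  case empty
  then show ?case
    by (simp add: collision_def heads_pmf_def)
next
  case (insert x A)
  define u where "u = collision A p"
  define u' where "u' = collision (insert x A) p"
  define m where "m = real (card A)"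
  have c: "0 < c" "c \<le> 1"
    using assms(1,2) mult_mono[of p0 1 "1 - p0" 1] by (auto simp: c_def)
  have px: "p x \<in> {p0..1 - p0}" "p x \<in> {0..1}"
    using insert.prems[of x] assms(1) by auto
  have IH: "u\<^sup>2 * (1 + 2 * c * m) \<le> 1"
    using insert by (simp add: u_def m_def)
  have u0: "0 \<le> u" "0 \<le> u'"
    by (simp_all add: u_def u'_def collision_nonneg)
  have "u\<^sup>2 * 1 \<le> u\<^sup>2 * (1 + 2 * c * m)"
    using c by (intro mult_left_mono) (auto simp: m_def)
  then have u1: "u\<^sup>2 \<le> 1" using IH by simp
  have "u' \<le> u - c * u ^ 3"
  proof -
    let ?D = "\<Sum>k\<le>Suc (card A). (pmf (heads_pmf A p) k - delayed (pmf (heads_pmf A p)) k)\<^sup>2"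
    have D: "u ^ 3 / 4 \<le> ?D"
      using discrete_Nash_inequality[of "pmf (heads_pmf A p)" "card A"]
        heads_pmf_beyond[OF insert.hyps(1), of _ p] sum_heads_pmf[OF insert.hyps(1), of p]
      by (simp add: u_def collision_def)
    have "0 \<le> (p x - p0) * (1 - p0 - p x)"
      using px by simp
    then have "p0 * (1 - p0) \<le> p x * (1 - p x)"
      by (simp add: algebra_simps)
    then have "p0 * (1 - p0) * (u ^ 3 / 4) \<le> p x * (1 - p x) * ?D"
      by (rule mult_mono[OF _ D]) (use u0(1) px(2) in simp_all)
    then show ?thesis
      using collision_insert[of A x p] insert.hyps px by (simp add: u_def u'_def c_def)
  qed
  also have "\<dots> = u * (1 - c * u\<^sup>2)"
    by (simp add: algebra_simps power2_eq_square power3_eq_cube)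
  finally have step: "u' \<le> u * (1 - c * u\<^sup>2)" .
  \<comment> \<open>The relative loss. What remains is \<open>(1 - z)\<^sup>2 (1 + 2 z) \<le> 1\<close>, where \<open>1 + 2 z\<close> comes
    from bounding \<open>u\<^sup>2 (1 + 2 c m)\<close> by \<open>1\<close>.\<close>
  define z where "z = c * u\<^sup>2"
  have z: "0 \<le> z" "z \<le> 1"
    using c u1 mult_mono[of c 1 "u\<^sup>2" 1] by (auto simp: z_def)
  have "u'\<^sup>2 \<le> u\<^sup>2 * (1 - z)\<^sup>2"
    using power_mono[OF step u0(2), of 2] by (simp add: power_mult_distrib z_def)
  then have "u'\<^sup>2 * (1 + 2 * c * (m + 1)) \<le> u\<^sup>2 * (1 - z)\<^sup>2 * (1 + 2 * c * (m + 1))"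
    using c by (intro mult_right_mono) (auto simp: m_def)
  also have "\<dots> = (1 - z)\<^sup>2 * (u\<^sup>2 * (1 + 2 * c * m) + 2 * z)"
    by (simp add: z_def algebra_simps)
  also have "\<dots> \<le> (1 - z)\<^sup>2 * (1 + 2 * z)"
    using IH by (intro mult_left_mono) auto
  also have "\<dots> = 1 - z\<^sup>2 * (3 - 2 * z)"
    by (simp add: power2_eq_square algebra_simps)
  also have "\<dots> \<le> 1"
    using z by simp
  finally show ?case
    using insert.hyps by (simp add: u'_def m_def add.commute)
qed

lemma convolution_le_collisions:
  assumes "finite A" "finite B"
  shows "(\<Sum>j\<le>k. pmf (heads_pmf A p) j * pmf (heads_pmf B p) (k - j))\<^sup>2 \<le> collision A p * collision B p"
proof -
  have le: "(\<Sum>j\<le>k. (pmf (heads_pmf C p) j)\<^sup>2) \<le> collision C p" if "finite C" for C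
  proof -
    have "(\<Sum>j\<le>k. (pmf (heads_pmf C p) j)\<^sup>2) = (\<Sum>j\<in>{..k} \<inter> {..card C}. (pmf (heads_pmf C p) j)\<^sup>2)"
      using that by (intro sum.mono_neutral_right) (auto dest: heads_pmf_support)
    also have "\<dots> \<le> collision C p"
      unfolding collision_def by (intro sum_mono2) auto
    finally show ?thesis .
  qed
  have "(\<Sum>j\<le>k. pmf (heads_pmf A p) j * pmf (heads_pmf B p) (k - j))\<^sup>2
      \<le> (\<Sum>j\<le>k. (pmf (heads_pmf A p) j)\<^sup>2) * (\<Sum>j\<le>k. (pmf (heads_pmf B p) (k - j))\<^sup>2)"
    by (rule Cauchy_Schwarz_ineq_sum)
  also have "(\<Sum>j\<le>k. (pmf (heads_pmf B p) (k - j))\<^sup>2) = (\<Sum>j\<le>k. (pmf (heads_pmf B p) j)\<^sup>2)"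
    by (rule sum.reindex_bij_witness[of _ "\<lambda>j. k - j" "\<lambda>j. k - j"]) auto
  also have "(\<Sum>j\<le>k. (pmf (heads_pmf A p) j)\<^sup>2) * \<dots> \<le> collision A p * collision B p"
    using le assms by (intro mult_mono) (auto simp: sum_nonneg collision_nonneg)
  finally show ?thesis .
qed

text \<open>
  Split the coins into two halves and bound the convolution of their distributions by
  Cauchy-Schwarz. If \<open>m\<close> is odd, the smaller half has only \<open>(m - 1) / 2\<close> coins; the summand \<open>1\<close> in
  \<open>1 + 2 c \<cdot> (m - 1) / 2\<close> makes up for the missing half coin because \<open>c \<le> 1\<close>.
\<close>

lemma heads_pmf_anticoncentration:
  assumes "0 < p0" "p0 < 1 / 2" "finite A" "A \<noteq> {}" "\<And>x. x \<in> A \<Longrightarrow> p x \<in> {p0..1 - p0}"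
  defines "c \<equiv> p0 * (1 - p0) / 4"
  shows "pmf (heads_pmf A p) k \<le> 1 / sqrt (c * card A)"
proof -
  have c: "0 < c" "c \<le> 1"
    using assms(1,2) mult_mono[of p0 1 "1 - p0" 1] by (auto simp: c_def)
  have cA: "c * card A > 0"
    using assms(3,4) c by (simp add: card_gt_0_iff)
  obtain B where B: "B \<subseteq> A" "card B = card A div 2" "finite B"
    using obtain_subset_with_card_n[of "card A div 2" A] assms(3) by (auto dest: finite_subset)
  define C where "C = A - B"
  have C: "finite C" "C \<subseteq> A" "B \<inter> C = {}" "B \<union> C = A" "card C = card A - card A div 2"
    using B assms(3) by (auto simp: C_def card_Diff_subset)
  have half: "(collision D p)\<^sup>2 \<le> 1 / (c * card A)" if "D \<subseteq> A" "finite D" "card A \<le> 2 * card D + 1" for D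
  proof -
    have "c * card A \<le> c * (2 * card D + 1)"
      using that(3) c by (intro mult_left_mono) linarith+
    then have "c * card A \<le> 1 + 2 * c * card D"
      using c by (simp add: algebra_simps)
    then have "(collision D p)\<^sup>2 * (c * card A) \<le> (collision D p)\<^sup>2 * (1 + 2 * c * card D)"
      by (intro mult_left_mono) auto
    also have "\<dots> \<le> 1"
      unfolding c_def using assms(1,2,5) that by (intro collision_bound) auto
    finally show ?thesis
      using cA by (simp add: field_simps)
  qed
  have "((pmf (heads_pmf A p) k)\<^sup>2)\<^sup>2 \<le> (collision B p * collision C p)\<^sup>2"
    using convolution_le_collisions[OF B(3) C(1), of p k] heads_pmf_union[OF B(3) C(1,3), of p k] C(4)
    by (intro power_mono) auto
  also have "\<dots> \<le> 1 / (c * card A) * (1 / (c * card A))"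
    unfolding power_mult_distrib using B C half[of B] half[of C] cA
    by (intro mult_mono) auto
  also have "\<dots> = (1 / (c * card A))\<^sup>2"
    by (simp add: power2_eq_square)
  finally have "(pmf (heads_pmf A p) k)\<^sup>2 \<le> 1 / (c * card A)"
    by (rule power2_le_imp_le) (rule divide_nonneg_pos[OF zero_le_one cA])
  then have "pmf (heads_pmf A p) k \<le> sqrt (1 / (c * card A))"
    by (rule real_le_rsqrt)
  then show ?thesis
    by (simp add: real_sqrt_divide)
qed

section \<open>Fresh coins hitting a prescribed number of heads\<close>

text \<open>
  Neither \<open>Q\<close> nor the target \<open>h\<close> looks at the coins in \<open>F\<close>. Conditionally on all other coins, the target is
  a constant, and the number of heads in \<open>F\<close> equals it with probability at most \<open>\<beta>\<close>.
\<close>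

lemma prob_fresh_coins:
  assumes I: "finite I" and F: "F \<subseteq> I"
    and Q: "\<And>\<omega> \<omega>'. \<forall>e\<in>I - F. \<omega> e = \<omega>' e \<Longrightarrow> Q \<omega> = Q \<omega>'"
    and h: "\<And>\<omega> \<omega>'. \<forall>e\<in>I - F. \<omega> e = \<omega>' e \<Longrightarrow> h \<omega> = h \<omega>'"
    and \<beta>: "\<And>k. pmf (heads_pmf F p) k \<le> \<beta>"
  shows "measure_pmf.prob (coin_flips I p) {\<omega>. Q \<omega> \<and> card {e \<in> F. \<omega> e} = h \<omega>}
    \<le> measure_pmf.prob (coin_flips I p) {\<omega>. Q \<omega>} * \<beta>"
proof -
  define merge where "merge f g = (\<lambda>e. if e \<in> I - F then f e else g e)" for f g :: "'a \<Rightarrow> bool"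
  have fin: "finite F" "finite (I - F)"
    using I F by (auto intro: finite_subset)
  have \<beta>0: "\<beta> \<ge> 0"
    using pmf_nonneg \<beta>[of 0] by (rule order_trans)
  have I_split: "coin_flips I p
      = map_pmf (\<lambda>(f, g). merge f g) (pair_pmf (coin_flips (I - F) p) (coin_flips F p))"
    using Pi_pmf_union[of "I - F" F False "\<lambda>a. bernoulli_pmf (p a)"] fin F
    by (simp add: merge_def Un_absorb2 Diff_disjoint Int_commute)
  have fubini: "emeasure (coin_flips I p) X
      = (\<integral>\<^sup>+f. emeasure (coin_flips F p) {g. merge f g \<in> X} \<partial>coin_flips (I - F) p)" for X
  proof -
    have "coin_flips I p = bind_pmf (coin_flips (I - F) p) (\<lambda>f. map_pmf (merge f) (coin_flips F p))"
      unfolding I_split pair_pmf_def by (simp add: map_pmf_def bind_assoc_pmf bind_return_pmf)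
    then show ?thesis
      by (simp add: vimage_def del: emeasure_pmf_UNIV)
  qed
  have Q_merge: "Q (merge f g) = Q f" and h_merge: "h (merge f g) = h f" for f g
    using Q[of "merge f g" f] h[of "merge f g" f] by (auto simp: merge_def)
  have F_merge: "{e \<in> F. merge f g e} = {e \<in> F. g e}" for f g
    by (auto simp: merge_def)
  have "emeasure (coin_flips I p) {\<omega>. Q \<omega> \<and> card {e \<in> F. \<omega> e} = h \<omega>}
      \<le> (\<integral>\<^sup>+f. ennreal \<beta> * indicator {f. Q f} f \<partial>coin_flips (I - F) p)"
    unfolding fubini
  proof (rule nn_integral_mono)
    fix f
    have "emeasure (coin_flips F p) {g. card {e \<in> F. g e} = k} \<le> ennreal \<beta>" for k
      using \<beta>[of k] by (simp add: heads_pmf_def pmf_map vimage_def measure_pmf.emeasure_eq_measure ennreal_leI)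
    then show "emeasure (coin_flips F p) {g. merge f g \<in> {\<omega>. Q \<omega> \<and> card {e \<in> F. \<omega> e} = h \<omega>}}
        \<le> ennreal \<beta> * indicator {f. Q f} f"
      by (auto simp: Q_merge h_merge F_merge indicator_def)
  qed
  also have "\<dots> = ennreal \<beta> * emeasure (coin_flips (I - F) p) {f. Q f}"
    by (simp add: nn_integral_cmult)
  also have "emeasure (coin_flips (I - F) p) {f. Q f} = emeasure (coin_flips I p) {\<omega>. Q \<omega>}"
  proof -
    have "emeasure (coin_flips I p) {\<omega>. Q \<omega>} = (\<integral>\<^sup>+f. indicator {f. Q f} f \<partial>coin_flips (I - F) p)"
      unfolding fubini by (intro nn_integral_cong) (auto simp: Q_merge indicator_def)
    then show ?thesis by simp
  qed
  finally show ?thesis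
    using \<beta>0 by (simp add: measure_pmf.emeasure_eq_measure ennreal_mult[symmetric] mult.commute)
qed

text \<open>
  Induction on the number of families: the conditions for the families treated before do not
  look at the coins of a new one, so they can be absorbed into \<open>Q\<close>.
\<close>

lemma prob_fresh_coin_families:
  assumes I: "finite I" and T: "finite T" and F: "\<And>v. v \<in> T \<Longrightarrow> F v \<subseteq> I"
    and disj: "disjoint_family_on F T"
    and Q: "\<And>\<omega> \<omega>'. \<forall>e\<in>I - (\<Union>v\<in>T. F v). \<omega> e = \<omega>' e \<Longrightarrow> Q \<omega> = Q \<omega>'"
    and h: "\<And>v \<omega> \<omega>'. v \<in> T \<Longrightarrow> \<forall>e\<in>I - (\<Union>v\<in>T. F v). \<omega> e = \<omega>' e \<Longrightarrow> h v \<omega> = h v \<omega>'"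
    and \<beta>: "\<And>v k. v \<in> T \<Longrightarrow> pmf (heads_pmf (F v) p) k \<le> \<beta>" and \<beta>0: "0 \<le> \<beta>"
  shows "measure_pmf.prob (coin_flips I p) {\<omega>. Q \<omega> \<and> (\<forall>v\<in>T. card {e \<in> F v. \<omega> e} = h v \<omega>)}
    \<le> measure_pmf.prob (coin_flips I p) {\<omega>. Q \<omega>} * \<beta> ^ card T"
  using T F disj Q h \<beta>
proof (induction T rule: finite_induct)
  case empty
  then show ?case by simp
next
  case (insert t T)
  define Q' where "Q' \<omega> \<longleftrightarrow> Q \<omega> \<and> (\<forall>v\<in>T. card {e \<in> F v. \<omega> e} = h v \<omega>)" for \<omega>
  have F_off_t: "F v \<subseteq> I - F t" if "v \<in> T" for v
    using that insert.hyps(2) insert.prems(1)[of v] insert.prems(2)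
    by (auto simp: disjoint_family_on_def)
  have Q'_cong: "Q' \<omega> = Q' \<omega>'" if eq: "\<forall>e\<in>I - F t. \<omega> e = \<omega>' e" for \<omega> \<omega>'
  proof -
    have "Q \<omega> = Q \<omega>'"
      by (rule insert.prems(3)) (use eq in blast)
    moreover have "h v \<omega> = h v \<omega>'" if "v \<in> T" for v
      by (rule insert.prems(4)) (use eq that in blast)+
    moreover have "{e \<in> F v. \<omega> e} = {e \<in> F v. \<omega>' e}" if "v \<in> T" for v
      using eq F_off_t[OF that] by blast
    ultimately show ?thesis
      by (simp add: Q'_def)
  qed
  have "measure_pmf.prob (coin_flips I p) {\<omega>. Q' \<omega> \<and> card {e \<in> F t. \<omega> e} = h t \<omega>}
      \<le> measure_pmf.prob (coin_flips I p) {\<omega>. Q' \<omega>} * \<beta>"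
  proof (rule prob_fresh_coins[OF I _ Q'_cong])
    fix \<omega> \<omega>' :: "'a \<Rightarrow> bool" assume eq: "\<forall>e\<in>I - F t. \<omega> e = \<omega>' e"
    show "h t \<omega> = h t \<omega>'"
      by (rule insert.prems(4)) (use eq in blast)+
  qed (use insert.prems(1,5) in auto)
  also have "\<dots> \<le> measure_pmf.prob (coin_flips I p) {\<omega>. Q \<omega>} * \<beta> ^ card T * \<beta>"
    unfolding Q'_def
  proof (rule mult_right_mono[OF insert.IH \<beta>0])
    show "disjoint_family_on F T"
      by (rule disjoint_family_on_mono[OF _ insert.prems(2)]) auto
    fix v assume v: "v \<in> T"
    show "F v \<subseteq> I" "\<And>k. pmf (heads_pmf (F v) p) k \<le> \<beta>"
      using v insert.prems(1,5) by blast+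
  next
    fix \<omega> \<omega>' :: "'a \<Rightarrow> bool" assume eq: "\<forall>e\<in>I - (\<Union>v\<in>T. F v). \<omega> e = \<omega>' e"
    show "Q \<omega> = Q \<omega>'"
      by (rule insert.prems(3)) (use eq in blast)
    show "h v \<omega> = h v \<omega>'" if "v \<in> T" for v
      by (rule insert.prems(4)) (use eq that in blast)+
  qed
  also have "{\<omega>. Q' \<omega> \<and> card {e \<in> F t. \<omega> e} = h t \<omega>}
      = {\<omega>. Q \<omega> \<and> (\<forall>v\<in>insert t T. card {e \<in> F v. \<omega> e} = h v \<omega>)}"
    by (auto simp: Q'_def)
  finally show ?case
    using insert.hyps by (simp add: mult_ac)
qed

section \<open>Degrees as numbers of heads\<close>

text \<open>
  The pairs \<open>{v, u}\<close> with \<open>u \<in> U\<close>, each given by its increasing representative, which is the index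
  of its coin.
\<close>

definition star :: "nat \<Rightarrow> nat \<Rightarrow> nat set \<Rightarrow> (nat \<times> nat) set" where
  "star n v U = {(i, j) \<in> vertex_pairs n. i = v \<and> j \<in> U \<or> j = v \<and> i \<in> U}"

definition graph_edges :: "nat \<Rightarrow> (nat \<times> nat \<Rightarrow> bool) \<Rightarrow> nat set set" where
  "graph_edges n \<omega> = {{i, j} | i j. (i, j) \<in> vertex_pairs n \<and> \<omega> (i, j)}"

lemma finite_vertex_pairs: "finite (vertex_pairs n)"
  by (rule finite_subset[of _ "{1..n} \<times> {1..n}"]) (auto simp: vertex_pairs_def)

lemma star_subset: "star n v U \<subseteq> vertex_pairs n"
  by (auto simp: star_def)

lemma finite_star: "finite (star n v U)"
  using star_subset finite_vertex_pairs by (rule finite_subset)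

lemma card_star:
  assumes "v \<in> {1..n}" "U \<subseteq> {1..n} - {v}"
  shows "card (star n v U) = card U"
proof -
  have "bij_betw (\<lambda>u. (min u v, max u v)) U (star n v U)"
    by (rule bij_betw_byWitness[where f' = "\<lambda>(i, j). if i = v then j else i"])
      (use assms in \<open>auto simp: star_def vertex_pairs_def min_def max_def subset_iff split: if_splits\<close>)
  then show ?thesis
    using bij_betw_same_card by fastforce
qed

lemma star_Un_heads:
  assumes "U \<inter> U' = {}"
  shows "card {e \<in> star n v (U \<union> U'). \<omega> e} = card {e \<in> star n v U. \<omega> e} + card {e \<in> star n v U'. \<omega> e}"
proof -
  have "{e \<in> star n v (U \<union> U'). \<omega> e} = {e \<in> star n v U. \<omega> e} \<union> {e \<in> star n v U'. \<omega> e}"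
    by (auto simp: star_def)
  moreover have "star n v U \<inter> star n v U' = {}"
    using assms by (auto simp: star_def vertex_pairs_def)
  ultimately show ?thesis
    using finite_star by (simp add: card_Un_disjoint disjoint_iff)
qed

lemma degree_in_induced:
  assumes "v \<in> S"
  shows "degree_in (induced_edges (graph_edges n \<omega>) S) v = card {e \<in> star n v (S - {v}). \<omega> e}"
proof -
  have "{e \<in> induced_edges (graph_edges n \<omega>) S. v \<in> e}
      = (\<lambda>(i, j). {i, j}) ` {e \<in> star n v (S - {v}). \<omega> e}"
    (is "?L = ?R")
  proof (intro equalityI subsetI)
    fix e assume "e \<in> ?L"
    then obtain i j where "e = {i, j}" "(i, j) \<in> vertex_pairs n" "\<omega> (i, j)" "v \<in> {i, j}" "{i, j} \<subseteq> S"
      by (auto simp: induced_edges_def graph_edges_def)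
    then show "e \<in> ?R"
      by (intro image_eqI[of _ _ "(i, j)"]) (auto simp: star_def vertex_pairs_def)
  next
    fix e assume "e \<in> ?R"
    then obtain i j where "e = {i, j}" "(i, j) \<in> star n v (S - {v})" "\<omega> (i, j)"
      by auto
    then show "e \<in> ?L"
      using assms by (auto simp: induced_edges_def graph_edges_def star_def)
  qed
  moreover have "inj_on (\<lambda>(i, j). {i, j}) {e \<in> star n v (S - {v}). \<omega> e}"
    by (auto simp: inj_on_def star_def vertex_pairs_def doubleton_eq_iff)
  ultimately show ?thesis
    by (simp add: degree_in_def card_image)
qed

lemma regular_event_graph_edges:
  "graph_edges n \<omega> \<in> regular_event S \<longleftrightarrow> (\<exists>d. \<forall>v\<in>S. card {e \<in> star n v (S - {v}). \<omega> e} = d)"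
  by (simp add: regular_event_def degree_in_induced)

lemma prob_cond_graph_pmf:
  "measure_pmf.prob (cond_graph_pmf n W x) X
    = measure_pmf.prob (coin_flips (vertex_pairs n) (\<lambda>(i, j). W (x i) (x j))) {\<omega>. graph_edges n \<omega> \<in> X}"
  by (simp add: cond_graph_pmf_def graph_edges_def vimage_def case_prod_unfold)

section \<open>Two overlapping regular subgraphs\<close>

text \<open>
  The union bound over the common degree \<open>d\<close> in \<open>S'\<close>, each degree being at most \<open>card S' - 1\<close>. For fixed \<open>d\<close>,
  the fresh coins of \<open>v \<in> S' - S\<close> are those of its star into \<open>S \<inter> S'\<close>. The stars of distinct
  \<open>v\<close> are disjoint, and they meet neither the pairs inside \<open>S\<close> nor those inside \<open>S' - S\<close>.
\<close>

lemma prob_regular_both_le: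
  assumes S: "S \<subseteq> {1..n}" "S' \<subseteq> {1..n}" "S \<inter> S' \<noteq> {}"
    and \<beta>: "\<And>v k. v \<in> S' - S \<Longrightarrow> pmf (heads_pmf (star n v (S \<inter> S')) p) k \<le> \<beta>" and \<beta>0: "0 \<le> \<beta>"
  defines "P \<equiv> measure_pmf.prob (coin_flips (vertex_pairs n) p)"
  shows "P {\<omega>. graph_edges n \<omega> \<in> regular_event S \<inter> regular_event S'}
    \<le> P {\<omega>. graph_edges n \<omega> \<in> regular_event S} * card S' * \<beta> ^ card (S' - S)"
proof -
  define K where "K = S \<inter> S'"
  define T where "T = S' - S"
  define R where "R \<omega> \<longleftrightarrow> graph_edges n \<omega> \<in> regular_event S" for \<omega>
  \<comment> \<open>The number of neighbours in \<open>K\<close> that \<open>v\<close> needs. Where the subtraction truncates, \<open>v\<close> already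
    has more than \<open>d\<close> neighbours in \<open>T\<close>, so the events \<open>E d\<close> still cover.\<close>
  define h where "h d v \<omega> = d - card {e \<in> star n v (T - {v}). \<omega> e}" for d v and \<omega> :: "nat \<times> nat \<Rightarrow> bool"
  define E where "E d = {\<omega>. R \<omega> \<and> (\<forall>v\<in>T. card {e \<in> star n v K. \<omega> e} = h d v \<omega>)}" for d
  have finT: "finite T"
    using S(2) by (auto simp: T_def intro: finite_subset)
  have R_cong: "R \<omega> = R \<omega>'" if eq: "\<forall>e\<in>vertex_pairs n - (\<Union>v\<in>T. star n v K). \<omega> e = \<omega>' e" for \<omega> \<omega>'
  proof -
    have "{e \<in> star n v (S - {v}). \<omega> e} = {e \<in> star n v (S - {v}). \<omega>' e}" if "v \<in> S" for v
    proof -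
      have "star n v (S - {v}) \<subseteq> vertex_pairs n - (\<Union>v\<in>T. star n v K)"
        using that by (auto simp: star_def T_def)
      then show ?thesis
        using eq by blast
    qed
    then show ?thesis
      by (simp add: R_def regular_event_graph_edges)
  qed
  have h_cong: "h d v \<omega> = h d v \<omega>'"
    if "v \<in> T" "\<forall>e\<in>vertex_pairs n - (\<Union>v\<in>T. star n v K). \<omega> e = \<omega>' e" for d v \<omega> \<omega>'
  proof -
    have "star n v (T - {v}) \<subseteq> vertex_pairs n - (\<Union>v\<in>T. star n v K)"
      using that(1) by (auto simp: star_def T_def K_def)
    then have "{e \<in> star n v (T - {v}). \<omega> e} = {e \<in> star n v (T - {v}). \<omega>' e}"
      using that(2) by blast
    then show ?thesis
      by (simp add: h_def)
  qed
  have E_bound: "P (E d) \<le> P {\<omega>. R \<omega>} * \<beta> ^ card T" for d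
    unfolding E_def P_def
  proof (rule prob_fresh_coin_families)
    show "disjoint_family_on (\<lambda>v. star n v K) T"
      by (auto simp: disjoint_family_on_def star_def T_def K_def)
    show "pmf (heads_pmf (star n v K) p) k \<le> \<beta>" if "v \<in> T" for v k
      using \<beta> that by (simp add: T_def K_def)
  qed (rule finT finite_vertex_pairs star_subset \<beta>0 | erule R_cong | erule (1) h_cong)+
  have "{\<omega>. graph_edges n \<omega> \<in> regular_event S \<inter> regular_event S'} \<subseteq> (\<Union>d<card S'. E d)"
  proof
    fix \<omega> assume "\<omega> \<in> {\<omega>. graph_edges n \<omega> \<in> regular_event S \<inter> regular_event S'}"
    then have R: "R \<omega>" and "graph_edges n \<omega> \<in> regular_event S'"
      by (simp_all add: R_def)
    then obtain d where d: "card {e \<in> star n v (S' - {v}). \<omega> e} = d" if "v \<in> S'" for v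
      unfolding regular_event_graph_edges by blast
    obtain v where v: "v \<in> S'"
      using S(3) by blast
    have "d \<le> card (star n v (S' - {v}))"
      unfolding d[OF v, symmetric] by (intro card_mono finite_star) blast
    also have "\<dots> = card (S' - {v})"
      using v S(2) by (intro card_star) auto
    also have "\<dots> < card S'"
      using v finite_subset[OF S(2)] by (intro card_Diff1_less) auto
    finally have "d < card S'" .
    moreover have "card {e \<in> star n v K. \<omega> e} = h d v \<omega>" if "v \<in> T" for v
    proof -
      have "S' - {v} = K \<union> (T - {v})" "K \<inter> (T - {v}) = {}"
        using that by (auto simp: T_def K_def)
      then have "card {e \<in> star n v K. \<omega> e} + card {e \<in> star n v (T - {v}). \<omega> e} = d"
        using d[of v] that by (simp add: star_Un_heads T_def)
      then show ?thesis
        by (simp add: h_def)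
    qed
    ultimately show "\<omega> \<in> (\<Union>d<card S'. E d)"
      using R by (auto simp: E_def)
  qed
  then have "P {\<omega>. graph_edges n \<omega> \<in> regular_event S \<inter> regular_event S'} \<le> P (\<Union>d<card S'. E d)"
    unfolding P_def by (intro measure_pmf.finite_measure_mono) auto
  also have "\<dots> \<le> (\<Sum>d<card S'. P (E d))"
    unfolding P_def by (intro measure_pmf.finite_measure_subadditive_finite) auto
  also have "\<dots> \<le> (\<Sum>d<card S'. P {\<omega>. R \<omega>} * \<beta> ^ card T)"
    by (intro sum_mono E_bound)
  finally show ?thesis
    by (simp add: R_def T_def mult_ac)
qed

theorem lemma4p8:
  fixes p0 :: real
  assumes "0 < p0" and "p0 < 1 / 2"
  shows "\<exists>C1::real. C1 > 0 \<and>
    (\<forall>(n::nat) (W :: real \<Rightarrow> real \<Rightarrow> real) (L::real) (x :: nat \<Rightarrow> real)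
       (w::real) (c0::real) (S :: nat set) (S' :: nat set) (y::nat) (\<kappa>::nat).
       (\<forall>s\<in>{0..1}. \<forall>t\<in>{0..1}. W s t \<in> {p0..1 - p0}) \<longrightarrow>
       (\<forall>s\<in>{0..1}. \<forall>t\<in>{0..1}. W s t = W t s) \<longrightarrow>
       least_lipschitz_const L ({0..1} \<times> {0..1}) (\<lambda>(s, t). W s t) \<longrightarrow>
       L > 0 \<longrightarrow>
       (\<forall>i\<in>{1..n}. x i \<in> {0..1}) \<longrightarrow>
       w \<in> {0<..1} \<longrightarrow>
       c0 \<in> {0..1 - w} \<longrightarrow>
       S \<subseteq> window n x c0 w \<longrightarrow>
       S' \<subseteq> window n x c0 w \<longrightarrow>
       card S = y \<longrightarrow>
       card S' = y \<longrightarrow>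
       card (S \<inter> S') = \<kappa> \<longrightarrow>
       \<kappa> \<ge> 2 \<longrightarrow>
       measure_pmf.prob (cond_graph_pmf n W x) (regular_event S \<inter> regular_event S')
         \<le> measure_pmf.prob (cond_graph_pmf n W x) (regular_event S)
            * real y * (C1 / sqrt (real \<kappa>)) ^ (y - \<kappa>))"
proof -
  define c where "c = p0 * (1 - p0) / 4"
  have c_pos: "c > 0"
    using assms by (simp add: c_def)
  show ?thesis
  proof (intro exI[of _ "1 / sqrt c"] conjI allI impI)
    show "1 / sqrt c > 0"
      using c_pos by simp
  next
    fix n :: nat and W :: "real \<Rightarrow> real \<Rightarrow> real" and L :: real and x :: "nat \<Rightarrow> real"
      and w c\<^sub>0 :: real and S S' :: "nat set" and y \<kappa> :: nat
    assume W: "\<forall>s\<in>{0..1}. \<forall>t\<in>{0..1}. W s t \<in> {p0..1 - p0}"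
      and x: "\<forall>i\<in>{1..n}. x i \<in> {0..1}"
      and S: "S \<subseteq> window n x c\<^sub>0 w" and S': "S' \<subseteq> window n x c\<^sub>0 w"
      and y: "card S = y" and y': "card S' = y" and \<kappa>: "card (S \<inter> S') = \<kappa>" "\<kappa> \<ge> 2"
    define p where "p = (\<lambda>(i, j). W (x i) (x j))"
    define \<beta> where "\<beta> = 1 / sqrt c / sqrt \<kappa>"
    have sub: "S \<subseteq> {1..n}" "S' \<subseteq> {1..n}"
      using S S' by (auto simp: window_def)
    then have fin: "finite S" "finite S'"
      by (auto intro: finite_subset)
    have p: "p e \<in> {p0..1 - p0}" if "e \<in> vertex_pairs n" for e
    proof -
      obtain i j where e: "e = (i, j)" "i \<in> {1..n}" "j \<in> {1..n}"
        using \<open>e \<in> vertex_pairs n\<close> by (auto simp: vertex_pairs_def)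
      then have "x i \<in> {0..1}" "x j \<in> {0..1}"
        using x by blast+
      then show ?thesis
        using W e(1) by (auto simp: p_def)
    qed
    have "pmf (heads_pmf (star n v (S \<inter> S')) p) k \<le> \<beta>" if "v \<in> S' - S" for v k
    proof -
      have card: "card (star n v (S \<inter> S')) = \<kappa>"
        unfolding \<kappa>(1)[symmetric] using that sub by (intro card_star) auto
      then have "star n v (S \<inter> S') \<noteq> {}"
        using \<kappa>(2) by auto
      then have "pmf (heads_pmf (star n v (S \<inter> S')) p) k \<le> 1 / sqrt (c * card (star n v (S \<inter> S')))"
        unfolding c_def
        by (rule heads_pmf_anticoncentration[OF assms finite_star]) (use p star_subset in blast)
      also have "\<dots> = \<beta>"
        unfolding card \<beta>_def real_sqrt_mult by simp
      finally show ?thesis .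
    qed
    moreover have "card (S' - S) = y - \<kappa>"
      using card_Diff_subset_Int[of S' S] fin y' \<kappa>(1) by (simp add: Int_commute)
    moreover have "S \<inter> S' \<noteq> {}" "\<beta> \<ge> 0"
      using \<kappa> c_pos by (auto simp: \<beta>_def)
    ultimately have "measure_pmf.prob (coin_flips (vertex_pairs n) p)
          {\<omega>. graph_edges n \<omega> \<in> regular_event S \<inter> regular_event S'}
        \<le> measure_pmf.prob (coin_flips (vertex_pairs n) p) {\<omega>. graph_edges n \<omega> \<in> regular_event S}
          * real y * \<beta> ^ (y - \<kappa>)"
      using prob_regular_both_le[OF sub, of p \<beta>] y' by metis
    then show "measure_pmf.prob (cond_graph_pmf n W x) (regular_event S \<inter> regular_event S')
        \<le> measure_pmf.prob (cond_graph_pmf n W x) (regular_event S)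
          * real y * (1 / sqrt c / sqrt (real \<kappa>)) ^ (y - \<kappa>)"
      unfolding prob_cond_graph_pmf p_def[symmetric] \<beta>_def .
  qed
qed

end
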